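(* Let $A$ be a $k\times k$ complex matrix, and let $\chi_A(x)=(x-\alpha_1)^{m_1}(x-\alpha_2)^{m_2}\cdots(x-\alpha_s)^{m_s}$ be its characteristic polynomial, where $\alpha_1,\ldots,\alpha_s$ are distinct complex numbers. Then, for all $t\in\mathbb{C}$, $$e^{tA}=\sum_{i=0}^{k-1}\left[\sum_{p=1}^{s}\frac{e^{\alpha_p t}}{i!}\left(\sum_{r=0}^{m_p-1}\frac{t^{r}}{r!}L_{pr}^{(i)}(0)[\chi_A]\right)\right]A^{i}.$$
   Context: For a non-constant polynomial $P(x)=(x-\alpha_1)^{m_1}\cdots(x-\alpha_s)^{m_s}$ with $\alpha_1,\ldots,\alpha_s\in\mathbb{C}$ distinct and $m_1,\ldots,m_s$ nonnegative integers, set, for $1\le j\le s$, $P_j(x)=\prod_{i\ne j}(x-\alpha_i)^{m_i}=P(x)/(x-\alpha_j)^{m_j}$ and $g_j(x)=1/P_j(x)$. For $1\le j\le s$ and $0\le r\le m_j-1$ define the polynomial $$L_{jr}(x)[P]=P_j(x)(x-\alpha_j)^{r}\sum_{i=0}^{m_j-1-r}\frac{1}{i!}g_j^{(i)}(\alpha_j)(x-\alpha_j)^i.$$ $L_{jr}^{(l)}(x)[P]$ denotes its $l$-th derivative with respect to $x$, and $L_{jr}^{(l)}(0)[P]$ the value of that derivative at $x=0$. The matrix exponential is $e^{tA}=\sum_{n\ge 0}\frac{t^n}{n!}A^n$, and $A^0=I$. *)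

theory Defs
  imports "HOL-Analysis.Analysis" "Jordan_Normal_Form.Char_Poly"
begin

text \<open>
  Polynomials of the form \<open>P = (x - \<alpha> 1) ^ m 1 * \<dots> * (x - \<alpha> s) ^ m s\<close> are
  represented by the data \<open>s\<close>, \<open>\<alpha>\<close>, \<open>m\<close>; only the values of \<open>\<alpha>\<close> and \<open>m\<close> on
  \<open>{1..s}\<close> matter, and multiplicities may be zero.
\<close>

definition root_poly :: "nat \<Rightarrow> (nat \<Rightarrow> complex) \<Rightarrow> (nat \<Rightarrow> nat) \<Rightarrow> complex poly" where
  "root_poly s \<alpha> m = (\<Prod>i\<in>{1..s}. [:- \<alpha> i, 1:] ^ m i)"

definition root_cofactor :: "nat \<Rightarrow> (nat \<Rightarrow> complex) \<Rightarrow> (nat \<Rightarrow> nat) \<Rightarrow> nat \<Rightarrow> complex poly" where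
  "root_cofactor s \<alpha> m j = (\<Prod>i\<in>{1..s} - {j}. [:- \<alpha> i, 1:] ^ m i)"

definition cofactor_inv :: "nat \<Rightarrow> (nat \<Rightarrow> complex) \<Rightarrow> (nat \<Rightarrow> nat) \<Rightarrow> nat \<Rightarrow> complex \<Rightarrow> complex" where
  "cofactor_inv s \<alpha> m j x = 1 / poly (root_cofactor s \<alpha> m j) x"

text \<open>
  The summation index runs over \<open>0 \<le> i \<le> m j - 1 - r\<close>, i.e. \<open>i < m j - r\<close>; the
  polynomial is meaningful for \<open>1 \<le> j \<le> s\<close> and \<open>r < m j\<close>.
\<close>

definition L_poly :: "nat \<Rightarrow> (nat \<Rightarrow> complex) \<Rightarrow> (nat \<Rightarrow> nat) \<Rightarrow> nat \<Rightarrow> nat \<Rightarrow> complex poly" where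
  "L_poly s \<alpha> m j r =
     root_cofactor s \<alpha> m j * [:- \<alpha> j, 1:] ^ r *
     (\<Sum>i<m j - r. Polynomial.smult (1 / fact i * (deriv ^^ i) (cofactor_inv s \<alpha> m j) (\<alpha> j))
                         ([:- \<alpha> j, 1:] ^ i))"

lemma root_poly_split:
  assumes "j \<in> {1..s}"
  shows "root_poly s \<alpha> m = [:- \<alpha> j, 1:] ^ m j * root_cofactor s \<alpha> m j"
  unfolding root_poly_def root_cofactor_def using assms by (intro prod.remove) auto

text \<open>
  The type of matrices carries no topology, so the series
  \<open>e\<^bsup>tA\<^esup> = (\<Sum>n. t ^ n / n! A ^ n)\<close> is summed entry by entry.
\<close>

definition mat_exp :: "complex \<Rightarrow> complex mat \<Rightarrow> complex mat" where
  "mat_exp t A = mat (dim_row A) (dim_row A)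
     (\<lambda>(a, b). \<Sum>n. ((t ^ n / fact n) \<cdot>\<^sub>m (A ^\<^sub>m n)) $$ (a, b))"

text \<open>All the entrywise series converge (absolutely), so \<open>suminf\<close> above is a genuine sum.\<close>

lemma norm_pow_mat_le:
  fixes A :: "complex mat"
  assumes A: "A \<in> carrier_mat k k" and a: "a < k" and b: "b < k"
    and C: "\<And>i j. i < k \<Longrightarrow> j < k \<Longrightarrow> norm (A $$ (i, j)) \<le> C"
  shows "norm ((A ^\<^sub>m n) $$ (a, b)) \<le> (real k * C) ^ n"
  using b
proof (induction n arbitrary: b)
  case 0
  then show ?case using A a by (simp add: one_mat_def)
next
  case (Suc n)
  have P: "A ^\<^sub>m n \<in> carrier_mat k k" using A by simp
  have C0: "0 \<le> C" using C[OF a a] norm_ge_zero order_trans by blast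
  have "(A ^\<^sub>m Suc n) $$ (a, b) = (\<Sum>i\<in>{0..<k}. (A ^\<^sub>m n) $$ (a, i) * A $$ (i, b))"
    using A P a Suc.prems by (simp add: scalar_prod_def)
  also have "norm \<dots> \<le> (\<Sum>i\<in>{0..<k}. (real k * C) ^ n * C)"
    using Suc C C0
    by (intro sum_norm_le) (auto simp: norm_mult intro!: mult_mono)
  also have "\<dots> = (real k * C) ^ Suc n" by simp
  finally show ?case .
qed

lemma summable_mat_exp:
  fixes A :: "complex mat"
  assumes A: "A \<in> carrier_mat k k" and a: "a < k" and b: "b < k"
  shows "summable (\<lambda>n. norm (((t ^ n / fact n) \<cdot>\<^sub>m (A ^\<^sub>m n)) $$ (a, b)))"
proof -
  define C where "C = (\<Sum>i<k. \<Sum>j<k. norm (A $$ (i, j)))"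
  have C: "norm (A $$ (i, j)) \<le> C" if "i < k" "j < k" for i j
  proof -
    have "norm (A $$ (i, j)) \<le> (\<Sum>j<k. norm (A $$ (i, j)))"
      using that by (intro member_le_sum) auto
    also have "\<dots> \<le> C"
      unfolding C_def using that
      by (intro member_le_sum[where f = "\<lambda>i. \<Sum>j<k. norm (A $$ (i, j))"])
         (auto intro: sum_nonneg)
    finally show ?thesis .
  qed
  show ?thesis
  proof (rule summable_comparison_test')
    show "summable (\<lambda>n. inverse (fact n) * (norm t * (real k * C)) ^ n)"
      by (rule summable_exp)
    fix n :: nat
    have P: "A ^\<^sub>m n \<in> carrier_mat k k" using A by simp
    have "norm (((t ^ n / fact n) \<cdot>\<^sub>m (A ^\<^sub>m n)) $$ (a, b))
            = norm t ^ n / fact n * norm ((A ^\<^sub>m n) $$ (a, b))"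
    proof -
      have "((t ^ n / fact n) \<cdot>\<^sub>m (A ^\<^sub>m n)) $$ (a, b) = t ^ n / fact n * (A ^\<^sub>m n) $$ (a, b)"
        by (rule index_smult_mat(1)) (use carrier_matD[OF P] a b in simp_all)
      then show ?thesis by (simp add: norm_mult norm_divide norm_power)
    qed
    also have "\<dots> \<le> norm t ^ n / fact n * (real k * C) ^ n"
      by (intro mult_left_mono norm_pow_mat_le[OF A a b C]) auto
    finally show "norm (norm (((t ^ n / fact n) \<cdot>\<^sub>m (A ^\<^sub>m n)) $$ (a, b)))
            \<le> inverse (fact n) * (norm t * (real k * C)) ^ n"
      by (simp add: field_simps power_mult_distrib)
  qed
qed

end

theory Submission
  imports Defs "HOL-Computational_Algebra.Field_as_Ring"
begin

text \<open>
  The polynomials \<open>L\<^bsub>pr\<^esub>\<close> are the fundamental polynomials of Hermite interpolation: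
  modulo \<open>(x - \<alpha>\<^sub>p) ^ m\<^sub>p\<close> the polynomial \<open>L\<^bsub>pr\<^esub>\<close> is \<open>(x - \<alpha>\<^sub>p) ^ r\<close>, because its last factor
  is a Taylor polynomial of \<open>1 / P\<^sub>p\<close> and cancels the factor \<open>P\<^sub>p\<close>, while modulo
  \<open>(x - \<alpha>\<^sub>q) ^ m\<^sub>q\<close> with \<open>q \<noteq> p\<close> it is zero. Hence a polynomial \<open>f\<close> is congruent modulo
  \<open>\<chi>\<^sub>A\<close> to the combination of the \<open>L\<^bsub>pr\<^esub>\<close> weighted by the Taylor coefficients of \<open>f\<close> at the
  \<open>\<alpha>\<^sub>p\<close> (\<open>hermite_interpolation\<close>): the congruence holds modulo each of the pairwise coprime
  factors of \<open>\<chi>\<^sub>A\<close>.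

  For \<open>f = x ^ n\<close> the Taylor coefficients are \<open>(n choose r) \<alpha>\<^sub>p ^ (n - r)\<close>, so the
  Cayley-Hamilton theorem (\<open>char_poly_annihilates\<close>) gives
  \<open>A ^ n = (\<Sum>p. \<Sum>r<m\<^sub>p. (n choose r) \<alpha>\<^sub>p ^ (n - r) L\<^bsub>pr\<^esub>(A))\<close>. Only the scalar factor depends
  on \<open>n\<close>, so the exponential series can be summed term by term; the series
  \<open>(\<Sum>n. t ^ n / n! (n choose r) \<alpha> ^ (n - r))\<close> has the value \<open>t ^ r / r! exp (\<alpha> t)\<close>
  (\<open>sums_exp_binomial\<close>). Since \<open>L\<^bsub>pr\<^esub>\<close> has degree less than \<open>k\<close> and its coefficients are
  its derivatives at zero divided by factorials, sorting the result by powers of \<open>A\<close> gives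
  the stated formula.
\<close>

section \<open>Polynomials in a matrix and the Cayley-Hamilton theorem\<close>

text \<open>
  This is the entry \<open>(a, b)\<close> of \<open>p(A)\<close>. For fixed \<open>A\<close>, \<open>a\<close> and \<open>b\<close> it is a linear functional
  on polynomials; working with these functionals keeps matrices of different dimensions, which
  share a type but do not form a ring, out of the algebra.
\<close>

definition mat_poly_entry :: "'a::comm_ring_1 mat \<Rightarrow> nat \<Rightarrow> nat \<Rightarrow> 'a poly \<Rightarrow> 'a" where
  "mat_poly_entry A a b p = (\<Sum>i\<le>degree p. coeff p i * (A ^\<^sub>m i) $$ (a, b))"

text \<open>
  Sums over a common range of exponents make linearity immediate, whereas \<open>degree\<close> is not
  additive.
\<close>

lemma mat_poly_entry_eq_sum:
  assumes "degree p < N"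
  shows "mat_poly_entry A a b p = (\<Sum>i<N. coeff p i * (A ^\<^sub>m i) $$ (a, b))"
  unfolding mat_poly_entry_def
  using assms by (intro sum.mono_neutral_left) (auto simp: coeff_eq_0)

lemma mat_poly_entry_add:
  "mat_poly_entry A a b (p + q) = mat_poly_entry A a b p + mat_poly_entry A a b q"
proof -
  define N where "N = Suc (max (degree p) (degree q))"
  have "degree p < N" "degree q < N" "degree (p + q) < N"
    using degree_add_le_max[of p q] by (auto simp: N_def)
  then show ?thesis
    by (simp add: mat_poly_entry_eq_sum[of _ N] algebra_simps sum.distrib)
qed

lemma mat_poly_entry_smult:
  "mat_poly_entry A a b (Polynomial.smult c p) = c * mat_poly_entry A a b p"
proof -
  have "degree p < Suc (degree p)" "degree (Polynomial.smult c p) < Suc (degree p)"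
    using degree_smult_le[of c p] by auto
  then show ?thesis
    by (simp only: mat_poly_entry_eq_sum[of _ "Suc (degree p)"] coeff_smult sum_distrib_left
        mult.assoc)
qed

lemma mat_poly_entry_0: "mat_poly_entry A a b 0 = 0"
  by (simp add: mat_poly_entry_def)

lemma mat_poly_entry_diff:
  "mat_poly_entry A a b (p - q) = mat_poly_entry A a b p - mat_poly_entry A a b q"
  using mat_poly_entry_add[of A a b "p - q" q] by simp

lemma mat_poly_entry_sum:
  "mat_poly_entry A a b (sum f S) = (\<Sum>x\<in>S. mat_poly_entry A a b (f x))"
  by (induction S rule: infinite_finite_induct)
    (simp_all add: mat_poly_entry_0 mat_poly_entry_add)

lemma mat_poly_entry_monom:
  "mat_poly_entry A a b (monom 1 n) = (A ^\<^sub>m n) $$ (a, b)"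
  by (subst mat_poly_entry_eq_sum[of _ "Suc n"])
    (auto simp: degree_monom_eq if_distrib[of "\<lambda>c. c * _"] cong: if_cong)

text \<open>This is \<open>(x p)(A) = p(A) A\<close>, read entrywise.\<close>

lemma mat_poly_entry_pCons_0:
  assumes A: "A \<in> carrier_mat k k" and a: "a < k" and b: "b < k"
  shows "mat_poly_entry A a b (pCons 0 p) = (\<Sum>j<k. mat_poly_entry A a j p * A $$ (j, b))"
proof -
  have step: "(A ^\<^sub>m Suc i) $$ (a, b) = (\<Sum>j<k. (A ^\<^sub>m i) $$ (a, j) * A $$ (j, b))" for i
  proof -
    have "A ^\<^sub>m i \<in> carrier_mat k k" using A by simp
    then show ?thesis using A a b by (simp add: scalar_prod_def atLeast0LessThan)
  qed
  have "mat_poly_entry A a b (pCons 0 p)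
      = (\<Sum>i<Suc (Suc (degree p)). coeff (pCons 0 p) i * (A ^\<^sub>m i) $$ (a, b))"
    using degree_pCons_le[of 0 p] by (intro mat_poly_entry_eq_sum) simp
  also have "\<dots> = (\<Sum>i<Suc (degree p). coeff p i * (A ^\<^sub>m Suc i) $$ (a, b))"
    by (subst sum.lessThan_Suc_shift) simp
  also have "\<dots> = (\<Sum>j<k. (\<Sum>i<Suc (degree p). coeff p i * (A ^\<^sub>m i) $$ (a, j)) * A $$ (j, b))"
    unfolding step sum_distrib_left sum_distrib_right
    by (subst sum.swap) (simp only: mult.assoc)
  finally show ?thesis by (simp only: mat_poly_entry_eq_sum[OF lessI])
qed

text \<open>
  This is the Cayley-Hamilton theorem. Let \<open>B\<close> be the adjugate of \<open>x I - A\<close>, so that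
  \<open>(x I - A) B = \<chi>\<^sub>A I\<close> over the polynomials. Reading the entries of the product \<open>q \<chi>\<^sub>A I\<close> as
  polynomials in \<open>A\<close> and adding them up along a column, the part with \<open>x\<close> and the part with
  \<open>A\<close> become the same double sum with the two summation indices exchanged, because
  multiplication by \<open>x\<close> acts as multiplication by \<open>A\<close>.
\<close>

lemma char_poly_annihilates:
  assumes A: "A \<in> carrier_mat k k" and a: "a < k" and b: "b < k"
    and dvd: "char_poly A dvd f"
  shows "mat_poly_entry A a b f = 0"
proof -
  obtain q where f: "f = char_poly A * q" using dvd by (elim dvdE)
  define M where "M = char_poly_matrix A"
  define B where "B = adj_mat M"
  have M: "M \<in> carrier_mat k k" using A by (simp add: M_def)
  have B: "B \<in> carrier_mat k k" using adj_mat(1)[OF M] by (simp add: B_def)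
  have MB: "M * B = char_poly A \<cdot>\<^sub>m 1\<^sub>m k"
    using adj_mat(2)[OF M] by (simp add: B_def M_def char_poly_def)
  have entry: "(if j = b then f else 0)
      = pCons 0 (q * B $$ (j, b)) - (\<Sum>l<k. Polynomial.smult (A $$ (j, l)) (q * B $$ (l, b)))"
    if j: "j < k" for j
  proof -
    have M_entry: "M $$ (j, l) = (if j = l then [:0, 1:] else 0) - [:A $$ (j, l):]" if "l < k" for l
      using A j that by (auto simp: M_def char_poly_matrix_def)
    have "(if j = b then f else 0) = (M * B) $$ (j, b) * q"
      unfolding MB f using j b by simp
    also have "(M * B) $$ (j, b) = (\<Sum>l<k. M $$ (j, l) * B $$ (l, b))"
      using M B j b by (simp add: scalar_prod_def atLeast0LessThan)
    also have "\<dots> = (\<Sum>l<k. (if j = l then [:0, 1:] * B $$ (l, b) else 0) - Polynomial.smult (A $$ (j, l)) (B $$ (l, b)))"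
      by (intro sum.cong refl) (auto simp: M_entry algebra_simps)
    also have "\<dots> = pCons 0 (B $$ (j, b)) - (\<Sum>l<k. Polynomial.smult (A $$ (j, l)) (B $$ (l, b)))"
      using j by (simp add: sum_subtractf)
    finally show ?thesis by (simp add: algebra_simps sum_distrib_left)
  qed
  \<comment> \<open>The zero entries \<open>j \<noteq> b\<close> are added so that \<open>entry\<close> applies along a whole column.\<close>
  have "mat_poly_entry A a b f = (\<Sum>j<k. mat_poly_entry A a j (if j = b then f else 0))"
    using b by (simp add: if_distrib mat_poly_entry_0 cong: if_cong)
  also have "\<dots> = (\<Sum>j<k. (\<Sum>l<k. mat_poly_entry A a l (q * B $$ (j, b)) * A $$ (l, j)))
      - (\<Sum>j<k. \<Sum>l<k. A $$ (j, l) * mat_poly_entry A a j (q * B $$ (l, b)))"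
    by (simp add: entry mat_poly_entry_diff mat_poly_entry_sum mat_poly_entry_smult
        mat_poly_entry_pCons_0[OF A a] sum_subtractf)
  also have "\<dots> = 0"
    by (subst sum.swap) (simp add: mult.commute)
  finally show ?thesis .
qed

section \<open>Taylor expansion as a congruence\<close>

lemma pcompose_linear_power:
  "pcompose ([:- a, 1:] ^ i) [:a, 1:] = monom (1 :: 'a :: {ring_char_0, idom}) i"
  by (rule poly_ext) (simp add: poly_pcompose poly_monom)

text \<open>
  Translation by \<open>a\<close> is an automorphism of the polynomial ring that moves \<open>x - a\<close> to \<open>x\<close>, and
  divisibility by a power of \<open>x\<close> is a condition on low-order coefficients.
\<close>

lemma linear_power_dvd_iff_coeff_shift:
  fixes f :: "'a :: {ring_char_0, idom} poly"
  shows "[:- a, 1:] ^ N dvd f \<longleftrightarrow> (\<forall>r<N. coeff (pcompose f [:a, 1:]) r = 0)"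
proof -
  have shift_back: "pcompose (pcompose f [:a, 1:]) [:- a, 1:] = f" for f :: "'a poly"
    by (rule poly_ext) (simp add: poly_pcompose)
  have unshift: "pcompose (monom 1 N) [:- a, 1:] = ([:- a, 1:] ^ N :: 'a poly)"
    by (rule poly_ext) (simp add: poly_pcompose poly_monom)
  have "[:- a, 1:] ^ N dvd f \<longleftrightarrow> monom 1 N dvd pcompose f [:a, 1:]"
  proof
    assume "[:- a, 1:] ^ N dvd f"
    then show "monom 1 N dvd pcompose f [:a, 1:]"
      by (auto elim!: dvdE simp: pcompose_mult pcompose_linear_power)
  next
    assume "monom 1 N dvd pcompose f [:a, 1:]"
    then obtain R where "pcompose f [:a, 1:] = monom 1 N * R" by (elim dvdE)
    then have "f = [:- a, 1:] ^ N * pcompose R [:- a, 1:]"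
      by (subst shift_back[symmetric]) (simp only: pcompose_mult unshift)
    then show "[:- a, 1:] ^ N dvd f" by (rule dvdI)
  qed
  then show ?thesis by (simp add: monom_1_dvd_iff')
qed

text \<open>
  The coefficients of \<open>f(x + a)\<close> are the Taylor coefficients of \<open>f\<close> at \<open>a\<close>.
\<close>

lemma taylor_mod_power:
  fixes f :: "'a :: {ring_char_0, idom} poly"
  shows "[:- a, 1:] ^ N dvd
    f - (\<Sum>r<N. Polynomial.smult (coeff (pcompose f [:a, 1:]) r) ([:- a, 1:] ^ r))"
  unfolding linear_power_dvd_iff_coeff_shift
  by (simp add: pcompose_diff pcompose_sum pcompose_smult pcompose_linear_power smult_monom coeff_sum)

text \<open>
  The Taylor polynomial of \<open>1 / P\<close> of order \<open>N\<close> inverts \<open>P\<close> modulo \<open>(x - a) ^ N\<close>. After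
  translation to the origin, the analytic derivatives of \<open>1 / P\<close> are the coefficients of the
  inverse of \<open>P\<close> as a formal power series, and the product of \<open>P\<close> with the truncated inverse
  agrees with \<open>1\<close> below degree \<open>N\<close>.
\<close>

lemma taylor_reciprocal_mod_power:
  fixes P :: "complex poly"
  assumes nz: "poly P a \<noteq> 0"
  shows "[:- a, 1:] ^ N dvd
    P * (\<Sum>i<N. Polynomial.smult (1 / fact i * (deriv ^^ i) (\<lambda>x. 1 / poly P x) a) ([:- a, 1:] ^ i)) - 1"
proof -
  define c where "c i = 1 / fact i * (deriv ^^ i) (\<lambda>x. 1 / poly P x) a" for i
  define Q where "Q = pcompose P [:a, 1:]"
  define T where "T = (\<Sum>i<N. monom (c i) i)"
  define G where "G = inverse (fps_of_poly Q)"
  have Q0: "fps_nth (fps_of_poly Q) 0 \<noteq> 0"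
    using nz by (simp add: Q_def flip: poly_0_coeff_0) (simp add: poly_pcompose)
  have "eval_fps (fps_of_poly Q) = poly Q" by (rule ext) simp
  then have "poly Q has_fps_expansion fps_of_poly Q"
    using eval_fps_has_fps_expansion[of "fps_of_poly Q"] by simp
  then have "(\<lambda>x. inverse (poly Q x)) has_fps_expansion G"
    unfolding G_def using Q0 by (rule has_fps_expansion_inverse)
  then have "fps_nth G i = (deriv ^^ i) (\<lambda>x. inverse (poly Q x)) 0 / fact i" for i
    by (rule fps_nth_fps_expansion)
  moreover have "(\<lambda>x. inverse (poly Q x)) = (\<lambda>x. 1 / poly P x) \<circ> (\<lambda>x. a + x)"
    by (auto simp: Q_def poly_pcompose fun_eq_iff field_simps)
  ultimately have c: "c i = fps_nth G i" for i
    unfolding c_def by (subst higher_deriv_shift_0) simp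
  have coeff_T: "coeff T i = fps_nth G i" if "i < N" for i
    using that by (simp add: T_def coeff_sum c)
  have "coeff (Q * T) i = fps_nth (fps_of_poly Q * G) i" if "i < N" for i
    unfolding coeff_mult fps_mult_nth atLeast0AtMost
    using that by (intro sum.cong) (auto simp: coeff_T)
  moreover have "fps_of_poly Q * G = 1"
    unfolding G_def using Q0 by (rule inverse_mult_eq_1')
  ultimately have "coeff (Q * T - 1) i = 0" if "i < N" for i
    using that by simp
  moreover have "pcompose (P * (\<Sum>i<N. Polynomial.smult (c i) ([:- a, 1:] ^ i)) - 1) [:a, 1:] = Q * T - 1"
    by (simp add: Q_def T_def pcompose_diff pcompose_mult pcompose_sum pcompose_smult
        pcompose_linear_power pcompose_1 smult_monom)
  ultimately show ?thesis
    unfolding linear_power_dvd_iff_coeff_shift c_def[symmetric] by simp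
qed

section \<open>Hermite interpolation\<close>

text \<open>The difference of the two linear polynomials is a nonzero constant.\<close>

lemma coprime_linear_powers:
  fixes a b :: complex
  assumes "a \<noteq> b"
  shows "coprime ([:- a, 1:] ^ i) ([:- b, 1:] ^ j)"
proof -
  have "coprime [:- a, 1:] [:- b, 1:]"
  proof (rule coprimeI)
    fix d assume "d dvd [:- a, 1:]" "d dvd [:- b, 1:]"
    then have "d dvd [:- a, 1:] - [:- b, 1:]" by (rule dvd_diff)
    moreover have "is_unit ([:- a, 1:] - [:- b, 1:])"
      using assms by (simp add: is_unit_poly_iff)
    ultimately show "is_unit d" by (rule dvd_unit_imp_unit)
  qed
  then show ?thesis by simp
qed

lemma root_poly_dvdI:
  assumes inj: "inj_on \<alpha> {1..s}"
    and dvd: "\<And>j. j \<in> {1..s} \<Longrightarrow> [:- \<alpha> j, 1:] ^ m j dvd f"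
  shows "root_poly s \<alpha> m dvd f"
proof -
  have "(\<Prod>i\<in>S. [:- \<alpha> i, 1:] ^ m i) dvd f" if "finite S" "S \<subseteq> {1..s}" for S
    using that
  proof (induction S rule: finite_induct)
    case (insert j S)
    have "coprime ([:- \<alpha> j, 1:] ^ m j) (\<Prod>i\<in>S. [:- \<alpha> i, 1:] ^ m i)"
      using insert inj
      by (intro prod_coprime_right coprime_linear_powers) (auto dest: inj_onD)
    then show ?case
      using insert dvd[of j] by (auto intro: divides_mult)
  qed simp
  then show ?thesis unfolding root_poly_def by simp
qed

lemma L_poly_dvd_other:
  assumes "q \<in> {1..s}" "q \<noteq> p"
  shows "[:- \<alpha> q, 1:] ^ m q dvd L_poly s \<alpha> m p r"
  unfolding L_poly_def root_cofactor_def mult.assoc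
  using assms by (intro dvd_mult2 dvd_prodI) auto

text \<open>
  The last factor of \<open>L\<^bsub>pr\<^esub>\<close> inverts \<open>P\<^sub>p\<close> only modulo \<open>(x - \<alpha>\<^sub>p) ^ (m\<^sub>p - r)\<close>; the factor
  \<open>(x - \<alpha>\<^sub>p) ^ r\<close> supplies the missing powers.
\<close>

lemma L_poly_mod_own:
  assumes inj: "inj_on \<alpha> {1..s}" and p: "p \<in> {1..s}" and r: "r < m p"
  shows "[:- \<alpha> p, 1:] ^ m p dvd L_poly s \<alpha> m p r - [:- \<alpha> p, 1:] ^ r"
proof -
  define P where "P = root_cofactor s \<alpha> m p"
  define T where "T = (\<Sum>i<m p - r. Polynomial.smult (1 / fact i * (deriv ^^ i) (\<lambda>x. 1 / poly P x) (\<alpha> p))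
                         ([:- \<alpha> p, 1:] ^ i))"
  have "poly P (\<alpha> p) \<noteq> 0"
    using inj p by (auto simp: P_def root_cofactor_def poly_prod dest: inj_onD)
  then have "[:- \<alpha> p, 1:] ^ (m p - r) dvd P * T - 1"
    unfolding T_def by (rule taylor_reciprocal_mod_power)
  then have "[:- \<alpha> p, 1:] ^ r * [:- \<alpha> p, 1:] ^ (m p - r) dvd [:- \<alpha> p, 1:] ^ r * (P * T - 1)"
    by (rule mult_dvd_mono[OF dvd_refl])
  moreover have "L_poly s \<alpha> m p r = P * [:- \<alpha> p, 1:] ^ r * T"
    by (simp add: L_poly_def P_def T_def cofactor_inv_def[abs_def])
  ultimately show ?thesis
    using r by (simp add: algebra_simps flip: power_add)
qed

text \<open>
  It suffices to compare both sides modulo each \<open>(x - \<alpha>\<^sub>q) ^ m\<^sub>q\<close>. There only the terms with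
  \<open>p = q\<close> survive, and they form the truncated Taylor expansion of \<open>f\<close> at \<open>\<alpha>\<^sub>q\<close>.
\<close>

lemma hermite_interpolation:
  assumes inj: "inj_on \<alpha> {1..s}"
  shows "root_poly s \<alpha> m dvd f - (\<Sum>p\<in>{1..s}. \<Sum>r<m p.
    Polynomial.smult (coeff (pcompose f [:\<alpha> p, 1:]) r) (L_poly s \<alpha> m p r))"
proof (rule root_poly_dvdI[OF inj])
  fix q assume q: "q \<in> {1..s}"
  let ?c = "\<lambda>p r. coeff (pcompose f [:\<alpha> p, 1:]) r"
  let ?X = "[:- \<alpha> q, 1:]"
  let ?own = "\<Sum>r<m q. Polynomial.smult (?c q r) (L_poly s \<alpha> m q r)"
  let ?rest = "\<Sum>p\<in>{1..s} - {q}. \<Sum>r<m p. Polynomial.smult (?c p r) (L_poly s \<alpha> m p r)"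
  have "?X ^ m q dvd f - (\<Sum>r<m q. Polynomial.smult (?c q r) (?X ^ r))"
    by (rule taylor_mod_power)
  moreover have "?X ^ m q dvd (\<Sum>r<m q. Polynomial.smult (?c q r) (L_poly s \<alpha> m q r - ?X ^ r))"
    using q by (intro dvd_sum dvd_smult L_poly_mod_own[OF inj]) auto
  moreover have "?X ^ m q dvd ?rest"
    using q by (intro dvd_sum dvd_smult L_poly_dvd_other) auto
  ultimately
  \<comment> \<open>The multiples of \<open>?X ^ r\<close> cancel, which leaves the interpolation error.\<close>
  have "?X ^ m q dvd (f - (\<Sum>r<m q. Polynomial.smult (?c q r) (?X ^ r)))
      - (\<Sum>r<m q. Polynomial.smult (?c q r) (L_poly s \<alpha> m q r - ?X ^ r)) - ?rest"
    by (blast intro: dvd_diff)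
  also have "\<dots> = f - (?own + ?rest)"
    by (simp add: smult_diff_right sum_subtractf)
  also have "?own + ?rest
      = (\<Sum>p\<in>{1..s}. \<Sum>r<m p. Polynomial.smult (?c p r) (L_poly s \<alpha> m p r))"
    using q by (intro sum.remove[symmetric]) auto
  finally show "?X ^ m q dvd f - \<dots>" .
qed

text \<open>
  This bound is what turns \<open>L\<^bsub>pr\<^esub>(A)\<close> into a combination of \<open>A ^ i\<close> with \<open>i < k\<close>.
\<close>

lemma degree_L_poly:
  assumes p: "p \<in> {1..s}" and r: "r < m p"
  shows "degree (L_poly s \<alpha> m p r) < degree (root_poly s \<alpha> m)"
proof -
  define P where "P = root_cofactor s \<alpha> m p"
  define T where "T = (\<Sum>i<m p - r. Polynomial.smult (1 / fact i * (deriv ^^ i) (cofactor_inv s \<alpha> m p) (\<alpha> p))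
                         ([:- \<alpha> p, 1:] ^ i))"
  have "P \<noteq> 0" by (auto simp: P_def root_cofactor_def)
  have "degree T \<le> m p - r - 1"
    unfolding T_def using r
    by (intro degree_sum_le order_trans[OF degree_smult_le]) (auto simp: degree_power_eq)
  moreover have "degree (P * [:- \<alpha> p, 1:] ^ r * T) \<le> degree P + r + degree T"
    by (intro order_trans[OF degree_mult_le] add_mono)
      (auto intro!: order_trans[OF degree_mult_le] simp: degree_power_eq)
  ultimately have "degree (L_poly s \<alpha> m p r) < degree P + m p"
    using r unfolding L_poly_def P_def T_def by linarith
  also have "\<dots> = degree (root_poly s \<alpha> m)"
    using p \<open>P \<noteq> 0\<close> by (simp add: root_poly_split degree_mult_eq degree_power_eq P_def)
  finally show ?thesis .
qed

section \<open>Summing the exponential series\<close>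

lemma coeff_shifted_monom:
  fixes c :: complex
  shows "coeff (pcompose (monom 1 n) [:c, 1:]) r = of_nat (n choose r) * c ^ (n - r)"
proof -
  have "pcompose (monom 1 n) [:c, 1:] = [:c, 1:] ^ n"
    by (rule poly_ext) (simp add: poly_pcompose poly_monom)
  moreover have "coeff ([:c, 1:] ^ n) r = 0" if "\<not> r \<le> n"
    using that by (intro coeff_eq_0) (simp add: degree_power_eq)
  ultimately show ?thesis
    by (cases "r \<le> n") (simp_all add: coeff_linear_poly_power binomial_eq_0)
qed

text \<open>
  The terms with \<open>n < r\<close> vanish, and \<open>(n choose r) / n! = 1 / (r! (n - r)!)\<close> splits off
  \<open>t ^ r / r!\<close> from a shifted exponential series.
\<close>

lemma sums_exp_binomial:
  fixes t a :: complex
  shows "(\<lambda>n. t ^ n / fact n * (of_nat (n choose r) * a ^ (n - r))) sums (t ^ r / fact r * exp (a * t))"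
proof -
  have "(\<lambda>n. t ^ r / fact r * ((a * t) ^ n /\<^sub>R fact n)) sums (t ^ r / fact r * exp (a * t))"
    by (intro sums_mult exp_converges)
  moreover have "t ^ r / fact r * ((a * t) ^ n /\<^sub>R fact n)
      = t ^ (n + r) / fact (n + r) * (of_nat ((n + r) choose r) * a ^ (n + r - r))" for n
    by (simp add: binomial_fact power_add power_mult_distrib scaleR_conv_of_real field_simps)
  ultimately show ?thesis
    by (subst sums_zero_iff_shift[of r, symmetric]) (simp_all add: binomial_eq_0)
qed

lemma index_finsum_mat:
  assumes "finite F" and "f \<in> F \<rightarrow> carrier_mat nr nc" and ab: "a < nr" "b < nc"
  shows "(\<Oplus>\<^bsub>module_mat TYPE('a::comm_ring_1) nr nc\<^esub> i \<in> F. f i) $$ (a, b) = (\<Sum>i\<in>F. f i $$ (a, b))"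
  using assms(1,2)
proof (induction F rule: finite_induct)
  case empty
  interpret abelian_group "module_mat TYPE('a) nr nc" by (rule abelian_group_mat)
  show ?case using ab by (simp add: module_mat_simps)
next
  case (insert x F)
  interpret abelian_group "module_mat TYPE('a) nr nc" by (rule abelian_group_mat)
  have "(\<Oplus>\<^bsub>module_mat TYPE('a) nr nc\<^esub> i \<in> F. f i) \<in> carrier_mat nr nc"
    using finsum_closed[of f F] insert by (auto simp: module_mat_simps)
  then show ?case
    using insert ab by (subst finsum_insert) (auto simp: module_mat_simps)
qed

lemma finsum_mat_closed:
  assumes "f \<in> F \<rightarrow> carrier_mat nr nc"
  shows "(\<Oplus>\<^bsub>module_mat TYPE('a::comm_ring_1) nr nc\<^esub> i \<in> F. f i) \<in> carrier_mat nr nc"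
proof -
  interpret abelian_group "module_mat TYPE('a) nr nc" by (rule abelian_group_mat)
  show ?thesis using finsum_closed[of f F] assms by (simp add: module_mat_simps)
qed

theorem theorem2p5:
  fixes A :: "complex mat" and k s :: nat
    and \<alpha> :: "nat \<Rightarrow> complex" and m :: "nat \<Rightarrow> nat"
  assumes "1 \<le> k"
    and "A \<in> carrier_mat k k"
    and "inj_on \<alpha> {1..s}"
    and "char_poly A = root_poly s \<alpha> m"
  shows "\<forall>t :: complex. mat_exp t A =
    (\<Oplus>\<^bsub>module_mat TYPE(complex) k k\<^esub> i \<in> {0..k - 1}.
       (\<Sum>p\<in>{1..s}. exp (\<alpha> p * t) / fact i *
          (\<Sum>r<m p. t ^ r / fact r * poly ((pderiv ^^ i) (L_poly s \<alpha> m p r)) 0))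
       \<cdot>\<^sub>m (A ^\<^sub>m i))"
proof (intro allI eq_matI)
  fix t :: complex
  note A = assms(2) and inj = assms(3)
  let ?L = "L_poly s \<alpha> m"
  let ?c = "\<lambda>i. \<Sum>p\<in>{1..s}. exp (\<alpha> p * t) / fact i *
          (\<Sum>r<m p. t ^ r / fact r * poly ((pderiv ^^ i) (?L p r)) 0)"
  let ?rhs = "\<Oplus>\<^bsub>module_mat TYPE(complex) k k\<^esub> i \<in> {0..k - 1}. ?c i \<cdot>\<^sub>m (A ^\<^sub>m i)"
  have Apow: "A ^\<^sub>m i \<in> carrier_mat k k" for i using A by simp
  have terms: "(\<lambda>i. ?c i \<cdot>\<^sub>m (A ^\<^sub>m i)) \<in> {0..k - 1} \<rightarrow> carrier_mat k k"
    using Apow by auto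
  have rhs: "?rhs \<in> carrier_mat k k" using terms by (rule finsum_mat_closed)
  show "dim_row (mat_exp t A) = dim_row ?rhs" "dim_col (mat_exp t A) = dim_col ?rhs"
    using A rhs by (auto simp: mat_exp_def)
  fix a b assume "a < dim_row ?rhs" "b < dim_col ?rhs"
  then have a: "a < k" and b: "b < k" using rhs by auto
  let ?E = "mat_poly_entry A a b"
  have deg: "degree (?L p r) < k" if "p \<in> {1..s}" "r < m p" for p r
    using degree_L_poly[of p s r m \<alpha>, OF that] degree_monic_char_poly[OF A] assms(4) by simp
  \<comment> \<open>Interpolation of \<open>x ^ n\<close>: the dependence on \<open>n\<close> is now confined to scalars.\<close>
  have power: "(A ^\<^sub>m n) $$ (a, b)
      = (\<Sum>p\<in>{1..s}. \<Sum>r<m p. of_nat (n choose r) * \<alpha> p ^ (n - r) * ?E (?L p r))" for n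
  proof -
    have "?E (monom 1 n - (\<Sum>p\<in>{1..s}. \<Sum>r<m p.
        Polynomial.smult (coeff (pcompose (monom 1 n) [:\<alpha> p, 1:]) r) (?L p r))) = 0"
      using hermite_interpolation[OF inj, of m "monom 1 n"]
      by (intro char_poly_annihilates[OF A a b]) (simp add: assms(4))
    moreover have "coeff (pcompose (monom 1 n) [:c, 1:]) r = of_nat (n choose r) * c ^ (n - r)"
      for c :: complex and r
      by (rule coeff_shifted_monom)
    ultimately show ?thesis
      by (simp add: mat_poly_entry_diff mat_poly_entry_sum mat_poly_entry_smult mat_poly_entry_monom)
  qed
  have "(\<lambda>n. t ^ n / fact n * (A ^\<^sub>m n) $$ (a, b))
      sums (\<Sum>p\<in>{1..s}. \<Sum>r<m p. t ^ r / fact r * exp (\<alpha> p * t) * ?E (?L p r))"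
  proof -
    have "(\<lambda>n. \<Sum>p\<in>{1..s}. \<Sum>r<m p.
        t ^ n / fact n * (of_nat (n choose r) * \<alpha> p ^ (n - r)) * ?E (?L p r))
      sums (\<Sum>p\<in>{1..s}. \<Sum>r<m p. t ^ r / fact r * exp (\<alpha> p * t) * ?E (?L p r))"
      by (intro sums_sum sums_mult2 sums_exp_binomial)
    then show ?thesis
      by (simp only: power sum_distrib_left mult.assoc)
  qed
  then have "mat_exp t A $$ (a, b)
      = (\<Sum>p\<in>{1..s}. \<Sum>r<m p. t ^ r / fact r * exp (\<alpha> p * t) * ?E (?L p r))"
    using A Apow a b by (simp add: mat_exp_def sums_iff)
  also have "\<dots> = (\<Sum>p\<in>{1..s}. \<Sum>r<m p. \<Sum>i<k.
      t ^ r / fact r * exp (\<alpha> p * t) * (coeff (?L p r) i * (A ^\<^sub>m i) $$ (a, b)))"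
    by (intro sum.cong refl) (simp add: mat_poly_entry_eq_sum[OF deg] sum_distrib_left)
  also have "\<dots> = (\<Sum>i<k. \<Sum>p\<in>{1..s}. \<Sum>r<m p.
      t ^ r / fact r * exp (\<alpha> p * t) * (coeff (?L p r) i * (A ^\<^sub>m i) $$ (a, b)))"
    by (simp only: sum.swap[of _ "{..<k}"])
  \<comment> \<open>The coefficient of \<open>x ^ i\<close> in a polynomial is its \<open>i\<close>-th derivative at \<open>0\<close> over \<open>i!\<close>.\<close>
  also have "\<dots> = (\<Sum>i<k. ?c i * (A ^\<^sub>m i) $$ (a, b))"
    by (simp add: poly_0_coeff_0 coeff_higher_pderiv pochhammer_fact[symmetric] sum_distrib_left sum_distrib_right mult_ac)
  also have "{..<k} = {0..k - 1}" using assms(1) by auto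
  also have "(\<Sum>i\<in>{0..k - 1}. ?c i * (A ^\<^sub>m i) $$ (a, b)) = ?rhs $$ (a, b)"
    using Apow A a b by (subst index_finsum_mat[OF _ terms]) simp_all
  finally show "mat_exp t A $$ (a, b) = ?rhs $$ (a, b)" .
qed

end
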